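(* Let $n\ge1$ and $s\ge1$. All cuts of $Q=Q^{(n,s)}$ are successive mutations of one another; that is, for any two cuts $C,C'$ of $Q$ there is a finite sequence of mutations of cuts leading from $C$ to $C'$.
   Context: $Q=Q^{(n,s)}$ is the quiver with vertices $Q_0=\{(\ell_1,\dots,\ell_{n+1})\in\mathbb Z_{\ge0}^{n+1}\mid\sum_i\ell_i=s-1\}$ and arrows $x\xrightarrow{i}x+f_i$ for each $i\in\{1,\dots,n+1\}$ and $x$ with $x,x+f_i\in Q_0$, where $f_i\in\mathbb Z^{n+1}$ has $-1$ in position $i$, $1$ in position $i+1$ and $0$ elsewhere for $i\le n$, and $f_{n+1}$ has $1$ in position $1$, $-1$ in position $n+1$ and $0$ elsewhere. A subset $C\subseteq Q_1$ of the arrows is a cut if it contains exactly one arrow from each $(n+1)$-cycle (oriented cycle of length $n+1$) of $Q$. For a cut $C$, $Q_C$ is the quiver obtained from $Q$ by removing all arrows in $C$ (keeping all vertices). If $x$ is a source of $Q_C$, then $\mu_x^+(C)\subseteq Q_1$ is obtained from $C$ by removing all arrows of $Q$ ending at $x$ and adding all arrows of $Q$ starting at $x$. Dually, if $x$ is a sink of $Q_C$, then $\mu_x^-(C)$ is obtained from $C$ by removing all arrows of $Q$ starting at $x$ and adding all arrows of $Q$ ending at $x$. Replacing $C$ by such a $\mu_x^+(C)$ or $\mu_x^-(C)$ (which are again cuts) is called mutation of cuts. *)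

theory Defs
  imports "Graph_Theory.Arc_Walk"
begin

text \<open>
  An element of \<open>\<int>\<^sup>n\<^sup>+\<^sup>1\<close> is a function \<open>nat \<Rightarrow> int\<close> that vanishes outside the positions
  \<open>1, \<dots>, n + 1\<close>. The arrow from \<open>x\<close> to \<open>x + arrow_vec n i\<close> labelled \<open>i\<close> is the pair \<open>(x, i)\<close>.
\<close>

definition arrow_vec :: "nat \<Rightarrow> nat \<Rightarrow> nat \<Rightarrow> int" where
  "arrow_vec n i = (if i \<le> n then (\<lambda>j. if j = i then -1 else if j = i + 1 then 1 else 0)
            else (\<lambda>j. if j = 1 then 1 else if j = n + 1 then -1 else 0))"

definition translate :: "nat \<Rightarrow> (nat \<Rightarrow> int) \<Rightarrow> nat \<Rightarrow> (nat \<Rightarrow> int)" where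
  "translate n x i = (\<lambda>j. x j + arrow_vec n i j)"

definition quiver_verts :: "nat \<Rightarrow> nat \<Rightarrow> (nat \<Rightarrow> int) set" where
  "quiver_verts n s =
     {x. (\<forall>j\<in>{1..n+1}. 0 \<le> x j) \<and> (\<forall>j. j \<notin> {1..n+1} \<longrightarrow> x j = 0) \<and>
         (\<Sum>j=1..n+1. x j) = int s - 1}"

definition quiver :: "nat \<Rightarrow> nat \<Rightarrow> (nat \<Rightarrow> int, (nat \<Rightarrow> int) \<times> nat) pre_digraph" where
  "quiver n s =
     \<lparr>verts = quiver_verts n s,
      arcs = {(x, i). x \<in> quiver_verts n s \<and> i \<in> {1..n+1} \<and> translate n x i \<in> quiver_verts n s},
      tail = (\<lambda>(x, i). x),
      head = (\<lambda>(x, i). translate n x i)\<rparr>"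

lemma wf_digraph_quiver: "wf_digraph (quiver n s)"
  by unfold_locales (auto simp: quiver_def)

definition is_cut :: "nat \<Rightarrow> nat \<Rightarrow> ((nat \<Rightarrow> int) \<times> nat) set \<Rightarrow> bool" where
  "is_cut n s C \<longleftrightarrow>
     C \<subseteq> arcs (quiver n s) \<and>
     (\<forall>p. pre_digraph.cycle (quiver n s) p \<and> length p = n + 1 \<longrightarrow> (\<exists>!a. a \<in> C \<and> a \<in> set p))"

definition cut_quiver ::
    "nat \<Rightarrow> nat \<Rightarrow> ((nat \<Rightarrow> int) \<times> nat) set \<Rightarrow> (nat \<Rightarrow> int, (nat \<Rightarrow> int) \<times> nat) pre_digraph" where
  "cut_quiver n s C = (quiver n s)\<lparr>arcs := arcs (quiver n s) - C\<rparr>"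

definition is_source :: "('a, 'b) pre_digraph \<Rightarrow> 'a \<Rightarrow> bool" where
  "is_source G x \<longleftrightarrow> x \<in> verts G \<and> in_arcs G x = {}"

definition is_sink :: "('a, 'b) pre_digraph \<Rightarrow> 'a \<Rightarrow> bool" where
  "is_sink G x \<longleftrightarrow> x \<in> verts G \<and> out_arcs G x = {}"

definition mu_plus ::
    "nat \<Rightarrow> nat \<Rightarrow> (nat \<Rightarrow> int) \<Rightarrow> ((nat \<Rightarrow> int) \<times> nat) set \<Rightarrow> ((nat \<Rightarrow> int) \<times> nat) set" where
  "mu_plus n s x C = (C - in_arcs (quiver n s) x) \<union> out_arcs (quiver n s) x"

definition mu_minus ::
    "nat \<Rightarrow> nat \<Rightarrow> (nat \<Rightarrow> int) \<Rightarrow> ((nat \<Rightarrow> int) \<times> nat) set \<Rightarrow> ((nat \<Rightarrow> int) \<times> nat) set" where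
  "mu_minus n s x C = (C - out_arcs (quiver n s) x) \<union> in_arcs (quiver n s) x"

inductive cut_mutation ::
    "nat \<Rightarrow> nat \<Rightarrow> ((nat \<Rightarrow> int) \<times> nat) set \<Rightarrow> ((nat \<Rightarrow> int) \<times> nat) set \<Rightarrow> bool"
  for n s where
  plus: "is_cut n s C \<Longrightarrow> is_source (cut_quiver n s C) x \<Longrightarrow> cut_mutation n s C (mu_plus n s x C)"
| minus: "is_cut n s C \<Longrightarrow> is_sink (cut_quiver n s C) x \<Longrightarrow> cut_mutation n s C (mu_minus n s x C)"

end

theory Submission
  imports Defs
begin

text \<open>
  A vertex is best pictured as \<open>s - 1\<close> particles placed on the cyclically arranged positions
  \<open>1, \<dots>, n + 1\<close>; the arrow labelled \<open>i\<close> moves one particle from position \<open>i\<close> to the next position.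
  A list of labels that contains each of \<open>1, \<dots>, n + 1\<close> once moves every particle configuration
  back to itself, and if all its moves are possible, it is an \<open>(n + 1)\<close>-cycle
  (\<open>cycle_label_walk\<close>).

  The heart of the matter is a vanishing-cohomology statement: an integer weight on the arrows whose
  sum along every \<open>(n + 1)\<close>-cycle is zero is the gradient of a function on the vertices
  (\<open>gradient_if_vanishes_on_cycles\<close>). The arrows with labels \<open>1, \<dots>, n\<close> strictly increase the total
  position of the particles, so a function with the right increments along them can be
  built by recursion on that height. It is consistent because two such arrows with the same target
  close up to a commutative square, whose two sides carry the same weight: both extend by one and the
  same return walk to an \<open>(n + 1)\<close>-cycle. The increment along an arrow labelled \<open>n + 1\<close> is then forced
  by the cycle that follows the moved particle once around.

  A cut is a set of arrows whose indicator \<open>d\<close> sums to 1 along every \<open>(n + 1)\<close>-cycle, and this yields two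
  gradients. First, \<open>(n + 1) d - 1\<close> is the gradient of some \<open>h\<close>; since its value is \<open>-1\<close> on the arrows
  outside the cut, \<open>h\<close> decreases along them, and the cut quiver is acyclic. Secondly, for two cuts the
  difference \<open>d - d'\<close> of their indicators is the gradient of some \<open>g\<close>, which may be taken nonnegative.
  Mutation of \<open>C\<close> at a source \<open>x\<close> of its cut quiver lowers \<open>g\<close> by 1 at \<open>x\<close> and changes it nowhere else.
  Now consider the vertices where \<open>g\<close> is maximal, and among them one, \<open>x\<close>, where \<open>h\<close> is maximal. An arrow
  into \<open>x\<close> outside \<open>C\<close> has gradient \<open>-d' \<le> 0\<close>, so it starts where \<open>g\<close> is maximal too, but there \<open>h\<close> would be
  larger. So \<open>x\<close> is a source. Mutating at such sources as long as \<open>g\<close> is positive somewhere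
  decreases the sum of \<open>g\<close> and ends with \<open>g = 0\<close>, which means that the two cuts agree
  (\<open>mutations_connect\<close>).
\<close>

section \<open>Walks described by their labels\<close>

text \<open>
  The cyclic predecessor of a position. The value 0 at other arguments is not a label, which
  makes the next formula valid for all \<open>j\<close>.
\<close>

definition cyc_pred :: "nat \<Rightarrow> nat \<Rightarrow> nat" where
  "cyc_pred n j = (if j = 1 then n + 1 else if j \<le> n + 1 then j - 1 else 0)"

lemma arrow_vec_eq_of_bool:
  assumes "n \<ge> 1" "i \<in> {1..n+1}"
  shows "arrow_vec n i j = of_bool (cyc_pred n j = i) - of_bool (j = i)"
  using assms by (auto simp: arrow_vec_def cyc_pred_def)

abbreviation endpoint :: "nat \<Rightarrow> (nat \<Rightarrow> int) \<Rightarrow> nat list \<Rightarrow> (nat \<Rightarrow> int)" where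
  "endpoint n x ls \<equiv> foldl (translate n) x ls"

fun label_walk :: "nat \<Rightarrow> (nat \<Rightarrow> int) \<Rightarrow> nat list \<Rightarrow> ((nat \<Rightarrow> int) \<times> nat) list" where
  "label_walk n x [] = []"
| "label_walk n x (i # ls) = (x, i) # label_walk n (translate n x i) ls"

lemma translate_inject:
  assumes "translate n x i = translate n y i"
  shows "x = y"
proof
  fix j
  show "x j = y j" using fun_cong[OF assms, of j] by (simp add: translate_def)
qed

lemma length_label_walk [simp]: "length (label_walk n x ls) = length ls"
  by (induction ls arbitrary: x) auto

lemma label_walk_append:
  "label_walk n x (ls @ ms) = label_walk n x ls @ label_walk n (endpoint n x ls) ms"
  by (induction ls arbitrary: x) auto

lemma cas_label_walk:
  "pre_digraph.cas (quiver n s) x (label_walk n x ls) (endpoint n x ls)"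
  by (induction ls arbitrary: x) (auto simp: pre_digraph.cas.simps quiver_def)

lemma set_awalk_verts_label_walk:
  "v \<in> set (pre_digraph.awalk_verts (quiver n s) x (label_walk n x ls)) \<longleftrightarrow>
    (\<exists>ps qs. ls = ps @ qs \<and> v = endpoint n x ps)"
proof (induction ls arbitrary: x)
  case Nil
  then show ?case by (simp add: pre_digraph.awalk_verts.simps)
next
  case (Cons i ls)
  have "(\<exists>ps qs. i # ls = ps @ qs \<and> v = endpoint n x ps) \<longleftrightarrow>
      v = x \<or> (\<exists>ps qs. ls = ps @ qs \<and> v = endpoint n (translate n x i) ps)" (is "?L \<longleftrightarrow> ?R")
  proof
    assume ?L
    then obtain ps qs where "i # ls = ps @ qs" "v = endpoint n x ps" by blast
    then show ?R by (cases ps) auto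
  next
    assume ?R
    then show ?L
    proof
      assume "v = x"
      then show ?L by (intro exI[of _ "[]"] exI[of _ "i # ls"]) simp
    next
      assume "\<exists>ps qs. ls = ps @ qs \<and> v = endpoint n (translate n x i) ps"
      then obtain ps qs where "ls = ps @ qs" "v = endpoint n (translate n x i) ps" by blast
      then show ?L by (intro exI[of _ "i # ps"] exI[of _ qs]) simp
    qed
  qed
  with Cons[of "translate n x i"] show ?case
    by (simp add: pre_digraph.awalk_verts.simps quiver_def)
qed

text \<open>
  Each label of the list acts once: position \<open>j\<close> gains a particle through the label before it and
  loses one through the label \<open>j\<close>.
\<close>

lemma endpoint_distinct:
  assumes "n \<ge> 1" "distinct ls" "set ls \<subseteq> {1..n+1}"
  shows "endpoint n x ls j = x j + of_bool (cyc_pred n j \<in> set ls) - of_bool (j \<in> set ls)"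
  using assms(2,3)
proof (induction ls arbitrary: x)
  case (Cons i ls)
  then have "i \<in> {1..n+1}" by auto
  with Cons show ?case
    by (auto simp: translate_def arrow_vec_eq_of_bool[OF assms(1)])
qed auto

lemma endpoint_all_labels:
  assumes "n \<ge> 1" "distinct ls" "set ls = {1..n+1}"
  shows "endpoint n x ls = x"
proof
  fix j
  have "cyc_pred n j \<in> {1..n+1} \<longleftrightarrow> j \<in> {1..n+1}"
    using assms(1) by (auto simp: cyc_pred_def)
  then show "endpoint n x ls j = x j"
    using endpoint_distinct[of n ls x j] assms by simp
qed

text \<open>
  The positions form a single orbit under the cyclic shift.
\<close>

lemma cyc_pred_closed_imp_all:
  assumes "S \<subseteq> {1..n+1}" "S \<noteq> {}" and closed: "\<And>j. j \<in> {1..n+1} \<Longrightarrow> cyc_pred n j \<in> S \<longleftrightarrow> j \<in> S"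
  shows "S = {1..n+1}"
proof -
  have up: "k + d \<in> S" if "k \<in> S" "k \<ge> 1" "k + d \<le> n + 1" for k d
    using that
  proof (induction d)
    case (Suc d)
    then show ?case using closed[of "k + Suc d"] by (auto simp: cyc_pred_def)
  qed auto
  obtain k where "k \<in> S" "k \<in> {1..n+1}" using assms(1,2) by blast
  with up[of k "n + 1 - k"] have "n + 1 \<in> S" by auto
  with closed[of 1] have "1 \<in> S" by (auto simp: cyc_pred_def)
  have "j \<in> S" if "j \<in> {1..n+1}" for j
    using up[OF \<open>1 \<in> S\<close>, of "j - 1"] that by auto
  with assms(1) show ?thesis by auto
qed

text \<open>
  Up to scaling, the only linear relation between the vectors of the arrows is that they sum to zero.
  This is why the cycles below do not meet a vertex twice.
\<close>

lemma endpoint_neq: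
  assumes "n \<ge> 1" "distinct ls" "set ls \<subset> {1..n+1}" "ls \<noteq> []"
  shows "endpoint n x ls \<noteq> x"
proof
  assume eq: "endpoint n x ls = x"
  have sub: "set ls \<subseteq> {1..n+1}" using assms(3) by auto
  have "cyc_pred n j \<in> set ls \<longleftrightarrow> j \<in> set ls" for j
    using endpoint_distinct[OF assms(1,2) sub, of x j] fun_cong[OF eq, of j]
    by (auto split: if_splits)
  then have "set ls = {1..n+1}"
    using cyc_pred_closed_imp_all[OF sub] assms(4) by auto
  with assms(3) show False by auto
qed

lemma distinct_awalk_verts_label_walk:
  assumes "n \<ge> 1" "distinct ls" "set ls \<subset> {1..n+1}"
  shows "distinct (pre_digraph.awalk_verts (quiver n s) x (label_walk n x ls))"
  using assms(2,3)
proof (induction ls arbitrary: x)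
  case Nil
  then show ?case by (simp add: pre_digraph.awalk_verts.simps)
next
  case (Cons i ls)
  have "x \<noteq> endpoint n x (i # ps)" if "ls = ps @ qs" for ps qs
  proof -
    have "set (i # ps) \<subseteq> set (i # ls)" using that by auto
    then have "set (i # ps) \<subset> {1..n+1}" using Cons.prems(2) by (rule subset_psubset_trans)
    then show ?thesis using endpoint_neq[OF assms(1), of "i # ps" x] Cons.prems(1) that by auto
  qed
  then have "x \<notin> set (pre_digraph.awalk_verts (quiver n s) (translate n x i)
      (label_walk n (translate n x i) ls))"
    unfolding set_awalk_verts_label_walk by auto
  moreover have "distinct (pre_digraph.awalk_verts (quiver n s) (translate n x i)
      (label_walk n (translate n x i) ls))"
    using Cons by auto
  ultimately show ?case by (simp add: pre_digraph.awalk_verts.simps quiver_def)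
qed

lemma translate_in_verts_iff:
  assumes "n \<ge> 1" "x \<in> quiver_verts n s" "i \<in> {1..n+1}"
  shows "translate n x i \<in> quiver_verts n s \<longleftrightarrow> x i > 0"
proof
  assume *: "translate n x i \<in> quiver_verts n s"
  then have "translate n x i i \<ge> 0" using assms by (auto simp: quiver_verts_def)
  then show "x i > 0" using assms
    by (auto simp: translate_def arrow_vec_def split: if_splits)
next
  assume pos: "x i > 0"
  let ?k = "if i \<le> n then i + 1 else 1"
  have av: "arrow_vec n i j = (if j = ?k then 1 else 0) - (if j = i then 1 else 0)" for j
    using assms by (auto simp: arrow_vec_def)
  have "(\<Sum>j=1..n+1. arrow_vec n i j) =
      (\<Sum>j=1..n+1. if j = ?k then 1 else 0) - (\<Sum>j=1..n+1. if j = i then 1 else 0)"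
    by (simp only: av sum_subtractf)
  also have "\<dots> = 0" using assms(1,3) by (simp add: sum.delta)
  finally have "(\<Sum>j=1..n+1. translate n x i j) = int s - 1"
    using assms(2) by (simp only: translate_def sum.distrib) (simp add: quiver_verts_def)
  moreover have "0 \<le> translate n x i j" if "j \<in> {1..n+1}" for j
    using that pos assms(2) by (auto simp: translate_def av quiver_verts_def)
  moreover have "translate n x i j = 0" if "j \<notin> {1..n+1}" for j
    using that assms by (auto simp: translate_def av quiver_verts_def)
  ultimately show "translate n x i \<in> quiver_verts n s"
    by (auto simp: quiver_verts_def)
qed

lemma arc_iff:
  assumes "n \<ge> 1"
  shows "(x, i) \<in> arcs (quiver n s) \<longleftrightarrow> x \<in> quiver_verts n s \<and> i \<in> {1..n+1} \<and> x i > 0"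
  using translate_in_verts_iff[OF assms] by (auto simp: quiver_def)

text \<open>
  The possibility of a sequence of moves with distinct labels, in terms of labels alone: \<open>A\<close> is the
  set of positions known to be occupied, and after the move \<open>i\<close> the position following \<open>i\<close> is occupied as
  well. A position need not be dropped from \<open>A\<close> when a particle leaves it, because its label does not
  occur again.
\<close>

fun fireable :: "nat \<Rightarrow> nat set \<Rightarrow> nat list \<Rightarrow> bool" where
  "fireable n A [] \<longleftrightarrow> True"
| "fireable n A (i # ls) \<longleftrightarrow> i \<in> A \<and> fireable n (A \<union> {j. cyc_pred n j = i}) ls"

lemma fireable_append:
  "fireable n A (ls @ ms) \<longleftrightarrow> fireable n A ls \<and> fireable n (A \<union> {j. cyc_pred n j \<in> set ls}) ms"
proof (induction ls arbitrary: A)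
  case (Cons i ls)
  have "A \<union> {j. cyc_pred n j = i} \<union> {j. cyc_pred n j \<in> set ls} =
      A \<union> {j. cyc_pred n j \<in> set (i # ls)}" by auto
  with Cons[of "A \<union> {j. cyc_pred n j = i}"] show ?case by simp
qed simp

lemma fireable_upt:
  assumes "a \<ge> 1" "b \<le> n + 2" "a < b \<Longrightarrow> a \<in> A"
  shows "fireable n A [a..<b]"
  using assms(2,3)
proof (induction b)
  case (Suc b)
  show ?case
  proof (cases "a \<le> b")
    case True
    then have "b \<in> A \<or> cyc_pred n b \<in> set [a..<b]"
      using Suc.prems assms(1) by (cases "a = b") (auto simp: cyc_pred_def)
    with Suc True show ?thesis by (auto simp: fireable_append)
  qed simp
qed simp

lemma label_walk_arcs:
  assumes "n \<ge> 1" "x \<in> quiver_verts n s" "distinct ls" "set ls \<subseteq> {1..n+1}"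
    and "fireable n {j. x j > 0} ls"
  shows "set (label_walk n x ls) \<subseteq> arcs (quiver n s) \<and> endpoint n x ls \<in> quiver_verts n s"
  using assms(3-5)
proof (induction ls rule: rev_induct)
  case Nil
  then show ?case using assms by simp
next
  case (snoc i ls)
  then have IH: "set (label_walk n x ls) \<subseteq> arcs (quiver n s)" "endpoint n x ls \<in> quiver_verts n s"
    by (auto simp: fireable_append)
  have i: "i \<in> {1..n+1}" "i \<notin> set ls" using snoc.prems by auto
  have "x i \<ge> 0" using assms(2) i by (auto simp: quiver_verts_def)
  then have "endpoint n x ls i > 0"
    using snoc.prems endpoint_distinct[OF assms(1), of ls x i] i by (auto simp: fireable_append)
  then show ?case
    using IH i translate_in_verts_iff[OF assms(1) IH(2) i(1)]
    by (auto simp: label_walk_append arc_iff[OF assms(1)])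
qed

lemma cycle_label_walk:
  assumes "n \<ge> 1" "x \<in> quiver_verts n s" "distinct ls" "set ls = {1..n+1}"
    and "fireable n {j. x j > 0} ls"
  shows "pre_digraph.cycle (quiver n s) (label_walk n x ls) \<and> length (label_walk n x ls) = n + 1"
proof -
  have len: "length ls = n + 1" using distinct_card[OF assms(3)] assms(4) by simp
  then obtain i ls' where ls: "ls = i # ls'" by (cases ls) auto
  have "i \<in> {1..n+1}" "set ls' = {1..n+1} - {i}" using ls assms(3,4) by auto
  then have "set ls' \<subset> {1..n+1}" by blast
  then have "distinct (tl (pre_digraph.awalk_verts (quiver n s) x (label_walk n x ls)))"
    using distinct_awalk_verts_label_walk[OF assms(1), of ls' s "translate n x i"] assms(3)
    by (simp add: ls pre_digraph.awalk_verts.simps quiver_def)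
  moreover have "pre_digraph.awalk (quiver n s) x (label_walk n x ls) x"
    using label_walk_arcs[OF assms(1-3) _ assms(5)] assms(2,4) cas_label_walk[of n s x ls]
      endpoint_all_labels[OF assms(1,3,4)]
    by (simp add: pre_digraph.awalk_def quiver_def)
  ultimately show ?thesis
    using len by (auto simp: pre_digraph.cycle_def ls)
qed

text \<open>
  A single particle can always travel once around; hence every arrow lies on an \<open>(n + 1)\<close>-cycle.
\<close>

lemma cycle_around:
  assumes "n \<ge> 1" "(x, i) \<in> arcs (quiver n s)"
  defines "p \<equiv> label_walk n x ([i..<n+2] @ [1..<i])"
  shows "pre_digraph.cycle (quiver n s) p \<and> length p = n + 1"
  unfolding p_def
proof (rule cycle_label_walk[OF assms(1)])
  have x: "x \<in> quiver_verts n s" "i \<in> {1..n+1}" "x i > 0"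
    using assms(2) by (simp_all add: arc_iff[OF assms(1)])
  then show "x \<in> quiver_verts n s" "distinct ([i..<n+2] @ [1..<i])"
    "set ([i..<n+2] @ [1..<i]) = {1..n+1}" by auto
  show "fireable n {j. x j > 0} ([i..<n+2] @ [1..<i])"
    unfolding fireable_append using x
    by (intro conjI fireable_upt) (auto simp: cyc_pred_def)
qed

text \<open>
  After the moves \<open>i\<close> and \<open>j\<close>, in either order, with \<open>i < j\<close>, the particle at \<open>i + 1\<close> advances to
  \<open>j\<close>, and the particle at the position after \<open>j\<close> advances, past position \<open>n + 1\<close>, to \<open>i\<close>. The original
  configuration is restored since particles are indistinguishable.
\<close>

definition square_return :: "nat \<Rightarrow> nat \<Rightarrow> nat \<Rightarrow> nat list" where
  "square_return n i j = [i+1..<j] @ [j+1..<n+2] @ [1..<i]"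

lemma cycle_square:
  assumes "n \<ge> 1" "x \<in> quiver_verts n s" "x i > 0" "x j > 0" "1 \<le> i" "i < j" "j \<le> n + 1"
  assumes "{a, b} = {i, j}"
  defines "p \<equiv> label_walk n x (a # b # square_return n i j)"
  shows "pre_digraph.cycle (quiver n s) p \<and> length p = n + 1"
  unfolding p_def
proof (rule cycle_label_walk[OF assms(1)])
  have ab: "a = i \<and> b = j \<or> a = j \<and> b = i" using assms(8) by (auto simp: doubleton_eq_iff)
  show "x \<in> quiver_verts n s" by fact
  show "distinct (a # b # square_return n i j)" "set (a # b # square_return n i j) = {1..n+1}"
    using ab assms(5-7) by (auto simp: square_return_def)
  show "fireable n {j. x j > 0} (a # b # square_return n i j)"
    unfolding fireable.simps square_return_def fireable_append using assms(3-7) ab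
    by (intro conjI fireable_upt) (auto simp: cyc_pred_def)
qed

section \<open>Weights that vanish on short cycles are gradients\<close>

definition vanishes_on_cycles :: "nat \<Rightarrow> nat \<Rightarrow> ((nat \<Rightarrow> int) \<times> nat \<Rightarrow> int) \<Rightarrow> bool" where
  "vanishes_on_cycles n s w \<longleftrightarrow>
    (\<forall>p. pre_digraph.cycle (quiver n s) p \<and> length p = n + 1 \<longrightarrow> sum_list (map w p) = 0)"

lemma vanishes_on_cyclesD:
  assumes "vanishes_on_cycles n s w" "pre_digraph.cycle (quiver n s) p \<and> length p = n + 1"
  shows "sum_list (map w p) = 0"
  using assms unfolding vanishes_on_cycles_def by blast

definition height :: "nat \<Rightarrow> (nat \<Rightarrow> int) \<Rightarrow> nat" where
  "height n x = nat (\<Sum>j=1..n+1. int j * x j)"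

lemma height_translate:
  assumes "x \<in> quiver_verts n s" "i \<in> {1..n}"
  shows "height n (translate n x i) = Suc (height n x)"
proof -
  have "(\<Sum>j=1..n+1. int j * translate n x i j) =
      (\<Sum>j=1..n+1. int j * x j + (if j = i + 1 then int j else 0) - (if j = i then int j else 0))"
    using assms(2) by (intro sum.cong) (auto simp: translate_def arrow_vec_def algebra_simps)
  also have "\<dots> = (\<Sum>j=1..n+1. int j * x j) + int (i + 1) - int i"
    using assms(2) unfolding sum_subtractf sum.distrib by (simp add: sum.delta)
  finally have "(\<Sum>j=1..n+1. int j * translate n x i j) = (\<Sum>j=1..n+1. int j * x j) + 1"
    by simp
  moreover have "(\<Sum>j=1..n+1. int j * x j) \<ge> 0"
    using assms(1) by (intro sum_nonneg) (auto simp: quiver_verts_def)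
  ultimately show ?thesis unfolding height_def by simp
qed

text \<open>
  Distinct moves \<open>i\<close> and \<open>j\<close> that lead to the same configuration move different particles, so both can be
  undone.
\<close>

lemma common_predecessor:
  assumes "n \<ge> 1" "(a, i) \<in> arcs (quiver n s)" "(b, j) \<in> arcs (quiver n s)"
    and "translate n a i = translate n b j" "i \<le> n" "j \<le> n" "i < j"
  obtains z where "z \<in> quiver_verts n s" "z i > 0" "z j > 0"
    "translate n z j = a" "translate n z i = b"
proof
  let ?z = "\<lambda>k. a k - arrow_vec n j k"
  have a: "a \<in> quiver_verts n s" "i \<ge> 1" and b: "b \<in> quiver_verts n s" "j \<ge> 1" "b j > 0"
    and pos: "a i > 0" "b j > 0"
    using assms(2,3) by (auto simp: arc_iff[OF assms(1)])
  have eq: "a k + arrow_vec n i k = b k + arrow_vec n j k" for k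
    using fun_cong[OF assms(4), of k] by (simp add: translate_def)
  show "translate n ?z j = a" by (simp add: translate_def)
  show "translate n ?z i = b" using eq by (auto simp: translate_def algebra_simps fun_eq_iff)
  have nn: "a k \<ge> 0" "b k \<ge> 0" if "k \<in> {1..n+1}" for k
    using a b that by (auto simp: quiver_verts_def)
  show zi: "?z i > 0" and zj: "?z j > 0"
    using pos eq[of i] eq[of j] nn[of j] nn[of i] assms(5-7) a(2) by (auto simp: arrow_vec_def split: if_splits)
  have "a (j + 1) > 0"
    using eq[of "j+1"] nn[of "j+1"] assms(5-7) by (auto simp: arrow_vec_def split: if_splits)
  then have nonneg: "0 \<le> ?z k" if "k \<in> {1..n+1}" for k
    using nn[OF that] assms(6) by (auto simp: arrow_vec_def)
  have "(\<Sum>k=1..n+1. arrow_vec n j k) =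
      (\<Sum>k=1..n+1. (if k = j + 1 then 1 else 0) - (if k = j then 1 else 0))"
    using assms(6) by (intro sum.cong) (auto simp: arrow_vec_def)
  also have "\<dots> = 0" using assms(6) b by (simp only: sum_subtractf) (simp add: sum.delta)
  finally have "(\<Sum>k=1..n+1. ?z k) = int s - 1"
    using a(1) unfolding quiver_verts_def sum_subtractf by simp
  moreover have "?z k = 0" if "k \<notin> {1..n+1}" for k
    using that a(1) b(2) assms(6) by (auto simp: arrow_vec_def quiver_verts_def)
  ultimately show "?z \<in> quiver_verts n s"
    using nonneg unfolding quiver_verts_def by blast
qed

text \<open>
  Since labels at most \<open>n\<close> raise the height, the value of \<open>h\<close> at a vertex may be defined through any
  arrow that ends there, by recursion on the height; the squares show that the choice of the arrow does not
  matter.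
\<close>

lemma gradient_of_small_labels:
  assumes "n \<ge> 1" "vanishes_on_cycles n s w"
  obtains h where "\<And>x i. (x, i) \<in> arcs (quiver n s) \<Longrightarrow> i \<le> n \<Longrightarrow> h (translate n x i) = h x + w (x, i)"
proof -
  \<comment> \<open>\<open>P f y r\<close>: given the values \<open>f\<close> at smaller height, \<open>r\<close> is right at \<open>y\<close> for every arrow with label \<open>\<le> n\<close> into \<open>y\<close>.\<close>
  define P where "P f y r \<longleftrightarrow>
    (\<forall>x i. (x, i) \<in> arcs (quiver n s) \<and> i \<le> n \<and> translate n x i = y \<longrightarrow> r = f x + w (x, i))"
    for f y and r :: int
  have lower: "height n x < height n (translate n x i)" "x \<in> quiver_verts n s"
    if "(x, i) \<in> arcs (quiver n s)" "i \<le> n" for x i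
    using height_translate[of x n s i] that by (auto simp: quiver_def)
  have diamond: "f a + w (a, i) = f b + w (b, j)"
    if f: "\<forall>z. height n z < height n y \<longrightarrow> P f z (f z)"
      and ai: "(a, i) \<in> arcs (quiver n s)" "i \<le> n" "translate n a i = y"
      and bj: "(b, j) \<in> arcs (quiver n s)" "j \<le> n" "translate n b j = y"
      and "i < j" for f y a i b j
  proof -
    obtain z where z: "z \<in> quiver_verts n s" "z i > 0" "z j > 0"
      "translate n z j = a" "translate n z i = b"
      using common_predecessor[OF assms(1) ai(1) bj(1)] ai bj \<open>i < j\<close> by metis
    have ij: "1 \<le> i" "j \<le> n + 1" using ai bj by (auto simp: quiver_def)
    have arcs: "(z, i) \<in> arcs (quiver n s)" "(z, j) \<in> arcs (quiver n s)"
      using z ij ai(2) bj(2) \<open>i < j\<close> by (auto simp: arc_iff[OF assms(1)])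
    have "f a = f z + w (z, j)" "f b = f z + w (z, i)"
      using f lower[OF ai(1,2)] lower[OF bj(1,2)] arcs z ai bj unfolding P_def by metis+
    moreover have "w (z, i) + (w (b, j) + sum_list (map w (label_walk n y (square_return n i j)))) = 0"
      using vanishes_on_cyclesD[OF assms(2) cycle_square[OF assms(1) z(1-3) ij(1) \<open>i < j\<close> ij(2), of i j]]
      by (simp add: z(5) bj(3))
    moreover have "w (z, j) + (w (a, i) + sum_list (map w (label_walk n y (square_return n i j)))) = 0"
      using vanishes_on_cyclesD[OF assms(2) cycle_square[OF assms(1) z(1-3) ij(1) \<open>i < j\<close> ij(2), of j i]]
      by (simp add: z(4) ai(3) insert_commute)
    ultimately show ?thesis by linarith
  qed
  have "\<exists>h. \<forall>y. P h y (h y)"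
  proof (rule dependent_wf_choice[of "measure (height n)"])
    fix f g :: "(nat \<Rightarrow> int) \<Rightarrow> int" and y r
    assume "\<And>z. (z, y) \<in> measure (height n) \<Longrightarrow> f z = g z"
    then show "P f y r = P g y r" unfolding P_def using lower by (metis in_measure)
  next
    fix y and f :: "(nat \<Rightarrow> int) \<Rightarrow> int"
    assume "\<And>z. (z, y) \<in> measure (height n) \<Longrightarrow> P f z (f z)"
    then have f: "\<forall>z. height n z < height n y \<longrightarrow> P f z (f z)" by simp
    show "\<exists>r. P f y r"
    proof (cases "\<exists>x i. (x, i) \<in> arcs (quiver n s) \<and> i \<le> n \<and> translate n x i = y")
      case True
      then obtain a i where ai: "(a, i) \<in> arcs (quiver n s)" "i \<le> n" "translate n a i = y" by auto
      have "f a + w (a, i) = f b + w (b, j)"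
        if bj: "(b, j) \<in> arcs (quiver n s)" "j \<le> n" "translate n b j = y" for b j
      proof (cases i j rule: linorder_cases)
        case less
        then show ?thesis using diamond[OF f ai bj] by simp
      next
        case equal
        then have "a = b" using ai(3) bj(3) by (metis translate_inject)
        with equal show ?thesis by simp
      next
        case greater
        then show ?thesis using diamond[OF f bj ai] by simp
      qed
      then show ?thesis unfolding P_def by blast
    qed (auto simp: P_def)
  qed simp
  then show ?thesis using that unfolding P_def by blast
qed

lemma sum_list_label_walk_gradient:
  assumes "set (label_walk n x ls) \<subseteq> E"
    and "\<And>y i. (y, i) \<in> E \<Longrightarrow> i \<in> set ls \<Longrightarrow> h (translate n y i) = h y + (w (y, i) :: int)"
  shows "sum_list (map w (label_walk n x ls)) = h (endpoint n x ls) - h x"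
  using assms by (induction ls arbitrary: x) auto

text \<open>
  An arrow labelled \<open>n + 1\<close> moves a particle to position 1, from where the labels \<open>1, \<dots>, n\<close> bring it
  back; the weight of the return walk is already known to be a difference of values of \<open>h\<close>.
\<close>

lemma gradient_if_vanishes_on_cycles:
  assumes "n \<ge> 1" "vanishes_on_cycles n s w"
  obtains h where "\<And>x i. (x, i) \<in> arcs (quiver n s) \<Longrightarrow> w (x, i) = h (translate n x i) - h x"
proof -
  obtain h where h: "\<And>x i. (x, i) \<in> arcs (quiver n s) \<Longrightarrow> i \<le> n \<Longrightarrow> h (translate n x i) = h x + w (x, i)"
    using gradient_of_small_labels[OF assms] by blast
  have "w (x, i) = h (translate n x i) - h x" if xi: "(x, i) \<in> arcs (quiver n s)" for x i
  proof (cases "i \<le> n")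
    case False
    then have i: "i = n + 1" using xi by (auto simp: quiver_def)
    let ?y = "translate n x i" and ?ls = "[1..<i]"
    have walk: "label_walk n x ([i..<n+2] @ [1..<i]) = (x, i) # label_walk n ?y ?ls"
      by (simp add: i)
    note cyc = cycle_around[OF assms(1) xi, unfolded walk]
    then have "set (label_walk n ?y ?ls) \<subseteq> arcs (quiver n s)"
      by (auto simp: pre_digraph.cycle_def pre_digraph.awalk_def)
    then have "sum_list (map w (label_walk n ?y ?ls)) = h (endpoint n ?y ?ls) - h ?y"
      by (rule sum_list_label_walk_gradient) (use h i in auto)
    moreover have "endpoint n ?y ?ls = x"
    proof -
      have "set (i # ?ls) = {1..n+1}" using i by auto
      then show ?thesis
        using endpoint_all_labels[OF assms(1), of "i # ?ls" x] by simp
    qed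
    moreover have "w (x, i) + sum_list (map w (label_walk n ?y ?ls)) = 0"
      using cyc assms(2) by (auto simp: vanishes_on_cycles_def)
    ultimately show ?thesis by simp
  qed (use h[OF xi] in simp)
  then show thesis by (rule that)
qed

section \<open>Cuts and their mutations\<close>

lemma sum_list_of_bool_eq_1_iff:
  assumes "distinct p"
  shows "sum_list (map (\<lambda>a. of_bool (a \<in> C)) p) = (1 :: int) \<longleftrightarrow> (\<exists>!a. a \<in> C \<and> a \<in> set p)"
proof -
  have ex1: "card A = 1 \<longleftrightarrow> (\<exists>!a. a \<in> A)" for A :: "'a set"
    unfolding One_nat_def card_1_singleton_iff by auto
  have "sum_list (map (\<lambda>a. of_bool (a \<in> C)) p) = (\<Sum>a\<in>set p. of_bool (a \<in> C) :: int)"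
    using assms by (rule sum_list_distinct_conv_sum_set)
  also have "\<dots> = int (card {a \<in> set p. a \<in> C})"
    by (simp add: Int_def)
  finally have "sum_list (map (\<lambda>a. of_bool (a \<in> C)) p) = int (card {a \<in> set p. a \<in> C})" .
  then show ?thesis using ex1[of "{a \<in> set p. a \<in> C}"] by (simp add: conj_commute)
qed

text \<open>
  Cycles do not repeat arrows, so the cut condition is linear in the indicator function of the set. In
  this form it can be compared between cuts and carried through a mutation.
\<close>

lemma is_cut_iff_count:
  "is_cut n s C \<longleftrightarrow> C \<subseteq> arcs (quiver n s) \<and>
    (\<forall>p. pre_digraph.cycle (quiver n s) p \<and> length p = n + 1 \<longrightarrow>
      sum_list (map (\<lambda>a. of_bool (a \<in> C)) p) = (1 :: int))"
proof -
  have "sum_list (map (\<lambda>a. of_bool (a \<in> C)) p) = (1 :: int) \<longleftrightarrow> (\<exists>!a. a \<in> C \<and> a \<in> set p)"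
    if "pre_digraph.cycle (quiver n s) p" for p
  proof (rule sum_list_of_bool_eq_1_iff)
    show "distinct p" using that wf_digraph.cycle_conv[OF wf_digraph_quiver] by blast
  qed
  then show ?thesis unfolding is_cut_def by (simp cong: imp_cong)
qed

lemma sum_list_cas_gradient:
  assumes "pre_digraph.cas G u p v"
  shows "sum_list (map (\<lambda>a. g (head G a) - g (tail G a)) p) = g v - (g u :: int)"
  using assms by (induction p arbitrary: u) (auto simp: pre_digraph.cas.simps)

lemma translate_neq:
  assumes "n \<ge> 1" "i \<in> {1..n+1}"
  shows "translate n x i \<noteq> x"
proof
  assume "translate n x i = x"
  then have "arrow_vec n i i = 0" by (auto simp: translate_def fun_eq_iff)
  then show False using assms by (auto simp: arrow_vec_def split: if_splits)
qed

lemma source_arc_in: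
  assumes "is_source (cut_quiver n s C) x" "(y, i) \<in> arcs (quiver n s)" "translate n y i = x"
  shows "(y, i) \<in> C"
proof (rule ccontr)
  assume "(y, i) \<notin> C"
  then have "(y, i) \<in> in_arcs (cut_quiver n s C) x"
    using assms(2,3) by (simp add: cut_quiver_def quiver_def)
  with assms(1) show False by (simp add: is_source_def)
qed

text \<open>
  An arrow out of \<open>x\<close> lies on an \<open>(n + 1)\<close>-cycle that comes back to \<open>x\<close> by an arrow of the cut, and a
  cycle contains only one arrow of the cut.
\<close>

lemma source_no_cut_arc_out:
  assumes "n \<ge> 1" "is_cut n s C" "is_source (cut_quiver n s C) x"
    and xi: "(x, i) \<in> arcs (quiver n s)"
  shows "(x, i) \<notin> C"
proof
  assume "(x, i) \<in> C"
  have i: "i \<in> {1..n+1}" using xi by (auto simp: quiver_def)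
  define ms where "ms = [i+1..<n+2] @ [1..<i]"
  have ims: "[i..<n+2] @ [1..<i] = i # ms" using i by (simp add: ms_def upt_rec[of i])
  let ?p = "label_walk n x (i # ms)"
  have cyc: "pre_digraph.cycle (quiver n s) ?p \<and> length ?p = n + 1"
    using cycle_around[OF assms(1) xi] by (simp only: ims)
  have ms: "distinct (i # ms)" "set (i # ms) = {1..n+1}" using i by (auto simp: ms_def)
  \<comment> \<open>The last arrow of the cycle, labelled \<open>k\<close>, is the one that returns to \<open>x\<close>.\<close>
  have "ms \<noteq> []" using cyc assms(1) by auto
  then obtain ks k where ks: "ms = ks @ [k]" by (cases ms rule: rev_cases) auto
  let ?y = "endpoint n x (i # ks)"
  have "(?y, k) \<in> set ?p" by (simp add: ks label_walk_append)
  moreover have "set ?p \<subseteq> arcs (quiver n s)"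
    using cyc by (auto simp: pre_digraph.cycle_def pre_digraph.awalk_def)
  moreover have "translate n ?y k = x"
    using endpoint_all_labels[OF assms(1) ms, of x] by (simp add: ks)
  ultimately have "(?y, k) \<in> C"
    using source_arc_in[OF assms(3), of ?y k] by blast
  moreover have "k \<noteq> i" using ms(1) ks by auto
  ultimately show False
    using assms(2) cyc \<open>(?y, k) \<in> set ?p\<close> \<open>(x, i) \<in> C\<close> unfolding is_cut_def
    by (metis label_walk.simps(2) list.set_intros(1) prod.inject)
qed

text \<open>
  Mutation at a source subtracts from the indicator function of the cut the gradient of the indicator
  function of the vertex.
\<close>

lemma of_bool_mu_plus:
  assumes "n \<ge> 1" "is_cut n s C" "is_source (cut_quiver n s C) x" "(y, i) \<in> arcs (quiver n s)"
  shows "(of_bool ((y, i) \<in> mu_plus n s x C) :: int) =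
    of_bool ((y, i) \<in> C) - (of_bool (translate n y i = x) - of_bool (y = x))"
proof -
  have "i \<in> {1..n+1}" using assms(4) by (auto simp: quiver_def)
  then have "translate n y i \<noteq> y" by (rule translate_neq[OF assms(1)])
  then have "\<not> (translate n y i = x \<and> y = x)" by auto
  moreover have "(y, i) \<in> C" if "translate n y i = x"
    using source_arc_in[OF assms(3,4) that] .
  moreover have "(y, i) \<notin> C" if "y = x"
    using source_no_cut_arc_out[OF assms(1-3)] assms(4) that by simp
  ultimately show ?thesis
    using assms(4) by (auto simp: mu_plus_def in_arcs_def out_arcs_def quiver_def)
qed

text \<open>
  A gradient sums to zero along a closed walk, so the number of cut arrows on a cycle does not
  change.
\<close>

lemma is_cut_mu_plus:
  assumes "n \<ge> 1" "is_cut n s C" "is_source (cut_quiver n s C) x"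
  shows "is_cut n s (mu_plus n s x C)"
  unfolding is_cut_iff_count
proof (intro conjI allI impI)
  show "mu_plus n s x C \<subseteq> arcs (quiver n s)"
    using assms(2) by (auto simp: is_cut_def mu_plus_def out_arcs_def)
next
  fix p assume p: "pre_digraph.cycle (quiver n s) p \<and> length p = n + 1"
  then obtain u where u: "set p \<subseteq> arcs (quiver n s)" "pre_digraph.cas (quiver n s) u p u"
    by (auto simp: pre_digraph.cycle_def pre_digraph.awalk_def)
  let ?g = "\<lambda>y. of_bool (y = x) :: int"
  have "of_bool (a \<in> mu_plus n s x C) = of_bool (a \<in> C) -
      (?g (head (quiver n s) a) - ?g (tail (quiver n s) a))" if "a \<in> set p" for a
  proof (cases a)
    case (Pair y i)
    then have "(y, i) \<in> arcs (quiver n s)" using u(1) that by auto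
    from of_bool_mu_plus[OF assms this] show ?thesis by (simp add: Pair quiver_def)
  qed
  then have "sum_list (map (\<lambda>a. of_bool (a \<in> mu_plus n s x C)) p) =
      sum_list (map (\<lambda>a. of_bool (a \<in> C) -
        (?g (head (quiver n s) a) - ?g (tail (quiver n s) a))) p)"
    by (intro arg_cong[of _ _ sum_list] map_cong) auto
  also have "\<dots> = sum_list (map (\<lambda>a. of_bool (a \<in> C)) p) - 0"
    using sum_list_cas_gradient[OF u(2), of ?g] by (simp add: sum_list_subtractf)
  also have "\<dots> = 1" using assms(2) p by (simp add: is_cut_iff_count)
  finally show "sum_list (map (\<lambda>a. of_bool (a \<in> mu_plus n s x C)) p) = (1 :: int)" .
qed

text \<open>
  The weight \<open>(n + 1) d - 1\<close>, with \<open>d\<close> the indicator function of the cut, vanishes on \<open>(n + 1)\<close>-cycles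
  and is \<open>-1\<close> outside the cut. The existence of \<open>h\<close> makes the cut quiver acyclic.
\<close>

lemma cut_height:
  assumes "n \<ge> 1" "is_cut n s C"
  obtains h where "\<And>x i. (x, i) \<in> arcs (quiver n s) \<Longrightarrow> (x, i) \<notin> C \<Longrightarrow> h (translate n x i) < (h x :: int)"
proof -
  have "sum_list (map (\<lambda>a. (int n + 1) * of_bool (a \<in> C) - 1) p) =
      (int n + 1) * sum_list (map (\<lambda>a. of_bool (a \<in> C)) p) - int (length p)" for p
    by (induction p) (auto simp: algebra_simps)
  then have "vanishes_on_cycles n s (\<lambda>a. (int n + 1) * of_bool (a \<in> C) - 1)"
    using assms(2) by (simp add: vanishes_on_cycles_def is_cut_iff_count)
  then obtain h where h: "\<And>x i. (x, i) \<in> arcs (quiver n s) \<Longrightarrow>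
      (int n + 1) * of_bool ((x, i) \<in> C) - 1 = h (translate n x i) - h x"
    using gradient_if_vanishes_on_cycles[OF assms(1)] by blast
  show thesis by (rule that[of h]) (use h in fastforce)
qed

lemma cut_difference:
  assumes "n \<ge> 1" "is_cut n s C" "is_cut n s C'"
  obtains g where "\<And>x i. (x, i) \<in> arcs (quiver n s) \<Longrightarrow>
    of_bool ((x, i) \<in> C) - of_bool ((x, i) \<in> C') = g (translate n x i) - (g x :: int)"
proof -
  have "vanishes_on_cycles n s (\<lambda>a. of_bool (a \<in> C) - of_bool (a \<in> C'))"
    using assms(2,3) by (simp add: vanishes_on_cycles_def is_cut_iff_count sum_list_subtractf)
  then show thesis using gradient_if_vanishes_on_cycles[OF assms(1)] that by blast
qed

lemma finite_quiver_verts: "finite (quiver_verts n s)"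
proof (rule finite_subset)
  show "quiver_verts n s \<subseteq>
      {x. \<forall>j. (j \<in> {1..n+1} \<longrightarrow> x j \<in> {0..int s}) \<and> (j \<notin> {1..n+1} \<longrightarrow> x j = 0)}"
  proof (intro subsetI CollectI allI conjI impI)
    fix x j assume x: "x \<in> quiver_verts n s" and j: "j \<in> {1..n+1}"
    have "x j \<le> (\<Sum>j=1..n+1. x j)"
      using x by (intro member_le_sum[OF j]) (auto simp: quiver_verts_def)
    then show "x j \<in> {0..int s}" using x j by (auto simp: quiver_verts_def)
  qed (auto simp: quiver_verts_def)
qed (rule finite_set_of_finite_funs; simp)

lemma finite_maximizer:
  assumes "finite X" "X \<noteq> {}"
  obtains x where "x \<in> X" "\<And>y. y \<in> X \<Longrightarrow> f y \<le> (f x :: 'b :: linorder)"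
proof -
  have "Max (f ` X) \<in> f ` X" using assms by simp
  then obtain x where "x \<in> X" "f x = Max (f ` X)" by auto
  then show thesis using that assms(1) by simp
qed

text \<open>
  Mutations at sources alone suffice: as long as \<open>g\<close> has a positive value, some vertex where \<open>g\<close> is
  maximal is a source of the cut quiver of \<open>C\<close>, and the mutation there lowers the sum \<open>k\<close> of the values
  of \<open>g\<close> by 1.
\<close>

lemma mutations_connect:
  assumes "n \<ge> 1" "is_cut n s C" "is_cut n s C'"
    and "\<And>x i. (x, i) \<in> arcs (quiver n s) \<Longrightarrow>
      of_bool ((x, i) \<in> C) - of_bool ((x, i) \<in> C') = g (translate n x i) - (g x :: int)"
    and "\<And>x. x \<in> quiver_verts n s \<Longrightarrow> g x \<ge> 0"
    and "(\<Sum>x\<in>quiver_verts n s. g x) = int k"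
  shows "(cut_mutation n s)\<^sup>*\<^sup>* C C'"
  using assms(2,4-6)
proof (induction k arbitrary: C g rule: less_induct)
  case (less k)
  let ?V = "quiver_verts n s"
  note g = less.prems(2)
  show ?case
  proof (cases "\<forall>x\<in>?V. g x = 0")
    case True
    have "(x, i) \<in> C \<longleftrightarrow> (x, i) \<in> C'" if xi: "(x, i) \<in> arcs (quiver n s)" for x i
    proof -
      have "x \<in> ?V" "translate n x i \<in> ?V" using xi by (auto simp: quiver_def)
      then show ?thesis using g[OF xi] True by (auto simp: of_bool_def split: if_splits)
    qed
    moreover have "C \<subseteq> arcs (quiver n s)" "C' \<subseteq> arcs (quiver n s)"
      using less.prems(1) assms(3) by (auto simp: is_cut_def)
    ultimately have "C = C'" by auto
    then show ?thesis by simp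
  next
    case False
    then obtain x0 where x0: "x0 \<in> ?V" "g x0 \<noteq> 0" by blast
    obtain m where m: "m \<in> ?V" "\<And>y. y \<in> ?V \<Longrightarrow> g y \<le> g m"
      using finite_maximizer[OF finite_quiver_verts] x0(1) by (metis empty_iff)
    have "g m > 0" using m(2)[OF x0(1)] x0 less.prems(3)[OF x0(1)] by simp
    obtain h where h: "\<And>y i. (y, i) \<in> arcs (quiver n s) \<Longrightarrow> (y, i) \<notin> C \<Longrightarrow> h (translate n y i) < (h y :: int)"
      using cut_height[OF assms(1) less.prems(1)] by blast
    have "finite {y \<in> ?V. g y = g m}" "{y \<in> ?V. g y = g m} \<noteq> {}"
      using finite_quiver_verts m(1) by auto
    then obtain x where x: "x \<in> {y \<in> ?V. g y = g m}" "\<And>y. y \<in> {y \<in> ?V. g y = g m} \<Longrightarrow> h y \<le> h x"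
      using finite_maximizer[of _ h] by blast
    then have xV: "x \<in> ?V" and gx: "g x = g m" by auto
    have "(y, i) \<in> C" if yi: "(y, i) \<in> arcs (quiver n s)" "translate n y i = x" for y i
    proof (rule ccontr)
      assume "(y, i) \<notin> C"
      have "y \<in> ?V" using yi by (auto simp: quiver_def)
      \<comment> \<open>Outside \<open>C\<close> the gradient of \<open>g\<close> is at most 0, so \<open>y\<close> is a maximum of \<open>g\<close> with larger \<open>h\<close> than \<open>x\<close>.\<close>
      have "g m \<le> g y" using g[OF yi(1)] \<open>(y, i) \<notin> C\<close> yi(2) gx by (auto simp: of_bool_def split: if_splits)
      then have "h y \<le> h x" using m(2)[of y] x(2)[of y] \<open>y \<in> ?V\<close> by auto
      with h[OF yi(1) \<open>(y, i) \<notin> C\<close>] yi(2) show False by simp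
    qed
    then have source: "is_source (cut_quiver n s C) x"
      using xV by (auto simp: is_source_def cut_quiver_def in_arcs_def quiver_def)
    define D where "D = mu_plus n s x C"
    define g' where "g' y = g y - of_bool (y = x)" for y
    have "cut_mutation n s C D" unfolding D_def by (rule cut_mutation.plus[OF less.prems(1) source])
    moreover have "(cut_mutation n s)\<^sup>*\<^sup>* D C'"
    proof (rule less.IH)
      have "(\<Sum>y\<in>?V. g' y) = (\<Sum>y\<in>?V. g y) - (\<Sum>y\<in>?V. if y = x then 1 else 0)"
        unfolding g'_def sum_subtractf by (simp add: of_bool_def)
      then have sum': "(\<Sum>y\<in>?V. g' y) = int k - 1"
        using less.prems(4) finite_quiver_verts xV by (simp add: sum.delta)
      show nonneg: "g' y \<ge> 0" if "y \<in> ?V" for y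
        using that less.prems(3)[of y] \<open>g m > 0\<close> gx by (auto simp: g'_def)
      have "(\<Sum>y\<in>?V. g' y) \<ge> 0" using nonneg by (rule sum_nonneg)
      then show "k - 1 < k" "(\<Sum>y\<in>?V. g' y) = int (k - 1)" using sum' by auto
      show "is_cut n s D" unfolding D_def by (rule is_cut_mu_plus[OF assms(1) less.prems(1) source])
      show "of_bool ((y, i) \<in> D) - of_bool ((y, i) \<in> C') = g' (translate n y i) - g' y"
        if "(y, i) \<in> arcs (quiver n s)" for y i
        using g[OF that] of_bool_mu_plus[OF assms(1) less.prems(1) source that]
        unfolding D_def g'_def by linarith
    qed
    ultimately show ?thesis by (rule converse_rtranclp_into_rtranclp)
  qed
qed

theorem theorem5p11:
  fixes n s :: nat and C C' :: "((nat \<Rightarrow> int) \<times> nat) set"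
  assumes "n \<ge> 1" and "s \<ge> 1"
    and "is_cut n s C" and "is_cut n s C'"
  shows "(cut_mutation n s)\<^sup>*\<^sup>* C C'"
proof -
  let ?V = "quiver_verts n s"
  obtain g where g: "\<And>x i. (x, i) \<in> arcs (quiver n s) \<Longrightarrow>
      of_bool ((x, i) \<in> C) - of_bool ((x, i) \<in> C') = g (translate n x i) - (g x :: int)"
    using cut_difference[OF assms(1,3,4)] by blast
  define g' where "g' x = g x - Min (g ` ?V)" for x
  have nonneg: "g' x \<ge> 0" if "x \<in> ?V" for x
    using that finite_quiver_verts by (simp add: g'_def)
  then have "(\<Sum>x\<in>?V. g' x) = int (nat (\<Sum>x\<in>?V. g' x))"
    by (simp add: sum_nonneg)
  moreover have "of_bool ((x, i) \<in> C) - of_bool ((x, i) \<in> C') = g' (translate n x i) - g' x"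
    if "(x, i) \<in> arcs (quiver n s)" for x i
    using g[OF that] by (simp add: g'_def)
  ultimately show ?thesis
    using mutations_connect[OF assms(1,3,4), of g'] nonneg by blast
qed

end
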